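(* Let the time domain be $T=\mathbb N_0$; let $X$ and $Y$ be processes on $\Omega$ with time domain $\mathbb N_0$ and values in $E$; let $\mathsf P^X$ and $\mathsf P^Y$ be complete probability measures on $\Omega$ whose domains contain $\mathcal F^X_\infty$ and $\mathcal F^Y_\infty$, respectively, and which have the same null sets. Suppose furthermore that $S$ is both an $\overline{\mathcal F^X}^{\mathsf P^X}$- and an $\overline{\mathcal F^Y}^{\mathsf P^Y}$-stopping time, with $X^S=Y^S$ $\mathsf P^X$-a.s. and $\mathsf P^Y$-a.s. Then $$\overline{\mathcal F^X}^{\mathsf P^X}_S=\overline{\sigma(X^S)}^{\mathsf P^X}=\overline{\sigma(Y^S)}^{\mathsf P^Y}=\overline{\mathcal F^Y}^{\mathsf P^Y}_S.$$
   Context: $\Omega$ is a set and $(E,\mathcal E)$ is a measurable space. A process with time domain $\mathbb N_0$ is a collection $X=(X_n)_{n\in\mathbb N_0}$ of functions $\Omega\to E$, equivalently a map $\Omega\to E^{\mathbb N_0}$. Its natural filtration is $\mathcal F^X_n:=\sigma(X_0,\dots,X_n)$, and $\mathcal F^X_\infty:=\bigvee_n\mathcal F^X_n$. For a map $S:\Omega\to\mathbb N_0\cup\{\infty\}$ the stopped process is $X^S_n(\omega):=X_{S(\omega)\wedge n}(\omega)$, and $\sigma(X^S)$ is the $\sigma$-field generated by $X^S:\Omega\to(E^{\mathbb N_0},\mathcal E^{\otimes\mathbb N_0})$. For a filtration $\mathcal G$, $S$ is a $\mathcal G$-stopping time if $\{S\le n\}\in\mathcal G_n$ for all $n$, and then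 $\mathcal G_S:=\{A\in\mathcal G_\infty:A\cap\{S\le n\}\in\mathcal G_n\ \forall n\}$. For a complete probability measure $\mathsf P$ on $\Omega$ with collection of null sets $\mathcal N$: if its domain includes a $\sigma$-field $\mathcal A$, $\overline{\mathcal A}^{\mathsf P}:=\mathcal A\vee\mathcal N$; if its domain includes $\mathcal G_\infty$ for a filtration $\mathcal G$, $\overline{\mathcal G}^{\mathsf P}$ is the completed filtration $\overline{\mathcal G}^{\mathsf P}_n:=\mathcal G_n\vee\mathcal N$, and $\overline{\mathcal G}^{\mathsf P}_S$ denotes $(\overline{\mathcal G}^{\mathsf P})_S$. A property holds $\mathsf P$-a.s. if the set of $\omega$ where it fails is in the domain of $\mathsf P$ and of $\mathsf P$-measure zero. *)

theory Defs
  imports "HOL-Probability.Probability"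
begin

text \<open>
  The sigma-fields on \<open>\<Omega>\<close> compared below are systems of sets (\<open>'a set set\<close>) rather than values of
  type \<open>'a measure\<close>, so that equality of sigma-fields is literally \<open>(=)\<close>. A filtration is a map
  \<open>nat \<Rightarrow> 'a set set\<close>.
\<close>

definition natural_filtration ::
  "'a set \<Rightarrow> 'b measure \<Rightarrow> (nat \<Rightarrow> 'a \<Rightarrow> 'b) \<Rightarrow> nat \<Rightarrow> 'a set set" where
  "natural_filtration \<Omega> E X n = sigma_sets \<Omega> (\<Union>i\<le>n. sets (vimage_algebra \<Omega> (X i) E))"

definition filtration_infty :: "'a set \<Rightarrow> (nat \<Rightarrow> 'a set set) \<Rightarrow> 'a set set" where
  "filtration_infty \<Omega> G = sigma_sets \<Omega> (\<Union>n. G n)"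

definition completed_field :: "'a measure \<Rightarrow> 'a set set \<Rightarrow> 'a set set" where
  "completed_field P A = sigma_sets (space P) (A \<union> null_sets P)"

definition completed_filtration :: "'a measure \<Rightarrow> (nat \<Rightarrow> 'a set set) \<Rightarrow> nat \<Rightarrow> 'a set set" where
  "completed_filtration P G n = completed_field P (G n)"

text \<open>
  The library's \<^const>\<open>stopping_time\<close> takes values in the index set of the filtration, which
  excludes the value \<open>\<infinity>\<close> for filtrations indexed by \<^typ>\<open>nat\<close>. The two lemmas at the
  end show that the following notions are the library's ones for the filtration extended to
  \<^typ>\<open>enat\<close> by its join at \<open>\<infinity>\<close>.
\<close>

definition enat_stopping_time ::
  "'a set \<Rightarrow> (nat \<Rightarrow> 'a set set) \<Rightarrow> ('a \<Rightarrow> enat) \<Rightarrow> bool" where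
  "enat_stopping_time \<Omega> G S \<longleftrightarrow> (\<forall>n. {\<omega>\<in>\<Omega>. S \<omega> \<le> enat n} \<in> G n)"

definition stopped_field ::
  "'a set \<Rightarrow> (nat \<Rightarrow> 'a set set) \<Rightarrow> ('a \<Rightarrow> enat) \<Rightarrow> 'a set set" where
  "stopped_field \<Omega> G S =
     {A \<in> filtration_infty \<Omega> G. \<forall>n. A \<inter> {\<omega>\<in>\<Omega>. S \<omega> \<le> enat n} \<in> G n}"

text \<open>The minimum is always finite, so \<^const>\<open>the_enat\<close> is never applied to \<open>\<infinity>\<close>.\<close>

definition stopped_process ::
  "(nat \<Rightarrow> 'a \<Rightarrow> 'b) \<Rightarrow> ('a \<Rightarrow> enat) \<Rightarrow> 'a \<Rightarrow> nat \<Rightarrow> 'b" where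
  "stopped_process X S \<omega> n = X (the_enat (min (S \<omega>) (enat n))) \<omega>"

definition path_field :: "'a set \<Rightarrow> 'b measure \<Rightarrow> ('a \<Rightarrow> nat \<Rightarrow> 'b) \<Rightarrow> 'a set set" where
  "path_field \<Omega> E Z = sets (vimage_algebra \<Omega> Z (\<Pi>\<^sub>M n\<in>UNIV. E))"

lemma enat_stopping_time_iff_stopping_time:
  fixes F :: "enat \<Rightarrow> 'a measure"
  assumes "filtration \<Omega> F"
  shows "enat_stopping_time \<Omega> (\<lambda>n. sets (F (enat n))) S \<longleftrightarrow> stopping_time F S"
proof -
  have sp: "space (F t) = \<Omega>" for t
    using assms by (simp add: filtration_def)
  have "{\<omega>\<in>\<Omega>. S \<omega> \<le> \<infinity>} \<in> sets (F \<infinity>)"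
    using sets.top[of "F \<infinity>"] by (simp add: sp)
  then have "(\<forall>n. {\<omega>\<in>\<Omega>. S \<omega> \<le> enat n} \<in> sets (F (enat n))) \<longleftrightarrow>
      (\<forall>t. {\<omega>\<in>\<Omega>. S \<omega> \<le> t} \<in> sets (F t))"
    by (metis enat.exhaust)
  then show ?thesis
    by (simp add: enat_stopping_time_def stopping_time_def pred_def sp)
qed

lemma stopped_field_eq_pre_sigma:
  fixes F :: "enat \<Rightarrow> 'a measure"
  assumes F: "filtration \<Omega> F"
    and infty: "sets (F \<infinity>) = filtration_infty \<Omega> (\<lambda>n. sets (F (enat n)))"
    and S: "stopping_time F S"
  shows "stopped_field \<Omega> (\<lambda>n. sets (F (enat n))) S = sets (filtration.pre_sigma \<Omega> F S)"
proof -
  have sp: "space (F t) = \<Omega>" for t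
    using F by (simp add: filtration_def)
  have "A \<in> filtration_infty \<Omega> (\<lambda>n. sets (F (enat n))) \<and>
      (\<forall>n. A \<inter> {\<omega>\<in>\<Omega>. S \<omega> \<le> enat n} \<in> sets (F (enat n))) \<longleftrightarrow>
      (\<forall>t. {\<omega>\<in>A. S \<omega> \<le> t} \<in> sets (F t))" (is "?L \<longleftrightarrow> ?R") for A
  proof
    assume L: ?L
    then have "A \<in> sets (F \<infinity>)" by (simp add: infty)
    then have "A \<subseteq> \<Omega>" using sets.sets_into_space sp by metis
    then have eq: "{\<omega>\<in>A. S \<omega> \<le> t} = A \<inter> {\<omega>\<in>\<Omega>. S \<omega> \<le> t}" for t by auto
    show ?R
    proof
      fix t show "{\<omega>\<in>A. S \<omega> \<le> t} \<in> sets (F t)"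
        using L \<open>A \<in> sets (F \<infinity>)\<close> by (cases t) (simp_all add: eq[symmetric])
    qed
  next
    assume R: ?R
    then have "A \<in> sets (F \<infinity>)" using spec[OF R, of \<infinity>] by simp
    then have "A \<subseteq> \<Omega>" using sets.sets_into_space sp by metis
    then have "A \<inter> {\<omega>\<in>\<Omega>. S \<omega> \<le> t} = {\<omega>\<in>A. S \<omega> \<le> t}" for t by auto
    with R \<open>A \<in> sets (F \<infinity>)\<close> show ?L by (simp add: infty)
  qed
  then show ?thesis
    by (simp add: stopped_field_def filtration.sets_pre_sigma[OF F S])
qed

end

theory Submission
  imports Defs
begin

text \<open>
  On \<open>{S \<ge> n}\<close> the processes \<open>X\<close> and \<open>X\<^sup>S\<close> agree up to time \<open>n\<close>, so the trace on \<open>{S \<ge> n}\<close> of the completed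
  field at time \<open>n\<close> lies in the completion \<open>H\<close> of \<open>\<sigma>(X\<^sup>S)\<close> as soon as \<open>{S \<ge> n} \<in> H\<close>. Since
  \<open>{S \<ge> n + 1} = {S \<ge> n} - {S \<le> n}\<close>, the latter follows by induction on \<open>n\<close>, and then every event of
  the stopped field is in \<open>H\<close>, piece by piece on \<open>{S = n}\<close> and \<open>{S = \<infinity>}\<close>. This is the nontrivial
  inclusion in the two outer equalities; the middle one holds because preimages under \<open>X\<^sup>S\<close> and
  \<open>Y\<^sup>S\<close> differ by subsets of a null set.
\<close>

section \<open>Traces of generated sigma-fields, completions and filtrations\<close>

text \<open>The sets whose trace on \<open>D\<close> lies in \<open>H\<close> are closed under
  complement and countable union, so it suffices to test generators. The members of \<open>G\<close>
  themselves may lie outside \<open>H\<close>.\<close>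

lemma sigma_sets_Int_in_sigma_algebra:
  assumes H: "sigma_algebra \<Omega> H" and D: "D \<in> H"
    and G: "\<And>A. A \<in> G \<Longrightarrow> A \<inter> D \<in> H"
    and A: "A \<in> sigma_sets \<Omega> G"
  shows "A \<inter> D \<in> H"
proof -
  interpret H: sigma_algebra \<Omega> H by (rule H)
  show ?thesis
    using A
  proof induction
    case (Compl A)
    have "(\<Omega> - A) \<inter> D = D - A \<inter> D"
      using H.sets_into_space[OF D] by auto
    with Compl D show ?case by auto
  next
    case (Union A)
    then have "(\<Union>i. A i \<inter> D) \<in> H" by (intro H.countable_UN) auto
    then show ?case by simp
  qed (auto intro: G)
qed

lemma sigma_algebra_natural_filtration: "sigma_algebra \<Omega> (natural_filtration \<Omega> E X n)"
  unfolding natural_filtration_def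
  by (rule sigma_algebra_sigma_sets) (use sets.sets_into_space in fastforce)

lemma natural_filtration_mono:
  "m \<le> n \<Longrightarrow> natural_filtration \<Omega> E X m \<subseteq> natural_filtration \<Omega> E X n"
  unfolding natural_filtration_def by (intro sigma_sets_mono') force

lemma sigma_algebra_completed_field:
  assumes "A \<subseteq> Pow (space P)"
  shows "sigma_algebra (space P) (completed_field P A)"
  unfolding completed_field_def
  using assms by (intro sigma_algebra_sigma_sets) (auto dest: null_setsD2 sets.sets_into_space)

lemma subset_completed_field: "A \<subseteq> completed_field P A"
  by (auto simp: completed_field_def)

lemma null_sets_subset_completed_field: "null_sets P \<subseteq> completed_field P A"
  by (auto simp: completed_field_def)

lemma completed_field_mono: "A \<subseteq> B \<Longrightarrow> completed_field P A \<subseteq> completed_field P B"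
  unfolding completed_field_def by (intro sigma_sets_mono') auto

lemma completed_field_subset:
  assumes "sigma_algebra (space P) H" "A \<subseteq> H" "null_sets P \<subseteq> H"
  shows "completed_field P A \<subseteq> H"
  unfolding completed_field_def
  using assms by (intro sigma_algebra.sigma_sets_subset) auto

lemma filtration_infty_upper: "G n \<subseteq> filtration_infty \<Omega> G"
  by (auto simp: filtration_infty_def)

lemma sigma_algebra_filtration_infty:
  assumes "\<And>n. sigma_algebra \<Omega> (G n)"
  shows "sigma_algebra \<Omega> (filtration_infty \<Omega> G)"
proof -
  have "G n \<subseteq> Pow \<Omega>" for n
    using assms[of n] by (simp add: sigma_algebra_iff2)
  then show ?thesis
    unfolding filtration_infty_def by (intro sigma_algebra_sigma_sets) auto
qed

lemma sigma_algebra_stopped_field: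
  assumes G: "\<And>n. sigma_algebra \<Omega> (G n)" and S: "enat_stopping_time \<Omega> G S"
  shows "sigma_algebra \<Omega> (stopped_field \<Omega> G S)"
  unfolding sigma_algebra_iff2
proof (intro conjI ballI allI impI)
  interpret F: sigma_algebra \<Omega> "filtration_infty \<Omega> G"
    using G by (rule sigma_algebra_filtration_infty)
  interpret G: sigma_algebra \<Omega> "G n" for n by (rule G)
  have S: "{\<omega>\<in>\<Omega>. S \<omega> \<le> enat n} \<in> G n" for n
    using S by (auto simp: enat_stopping_time_def)
  show "stopped_field \<Omega> G S \<subseteq> Pow \<Omega>"
    using F.space_closed by (auto simp: stopped_field_def)
  show "{} \<in> stopped_field \<Omega> G S"
    by (auto simp: stopped_field_def)
  show "\<Omega> - A \<in> stopped_field \<Omega> G S" if "A \<in> stopped_field \<Omega> G S" for A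
  proof -
    \<comment> \<open>The complement is taken relative to \<open>{S \<le> n}\<close>, which is in
      \<open>G n\<close> because \<open>S\<close> is a stopping time.\<close>
    have "(\<Omega> - A) \<inter> {\<omega>\<in>\<Omega>. S \<omega> \<le> enat n} =
        {\<omega>\<in>\<Omega>. S \<omega> \<le> enat n} - A \<inter> {\<omega>\<in>\<Omega>. S \<omega> \<le> enat n}" for n by auto
    with that S show ?thesis by (auto simp: stopped_field_def)
  qed
  show "(\<Union>i. A i) \<in> stopped_field \<Omega> G S" if "range A \<subseteq> stopped_field \<Omega> G S"
    for A :: "nat \<Rightarrow> 'a set"
  proof -
    have "(\<Union>i. A i \<inter> {\<omega>\<in>\<Omega>. S \<omega> \<le> enat n}) \<in> G n" for n
      using that by (intro G.countable_UN) (auto simp: stopped_field_def)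
    moreover have "(\<Union>i. A i) \<in> filtration_infty \<Omega> G"
      using that by (intro F.countable_UN) (auto simp: stopped_field_def)
    ultimately show ?thesis
      by (simp add: stopped_field_def)
  qed
qed

section \<open>Stopped processes and sigma-fields generated by paths\<close>

lemma stopped_process_eq: "enat n \<le> S \<omega> \<Longrightarrow> stopped_process X S \<omega> n = X n \<omega>"
  by (simp add: stopped_process_def min_def order_antisym)

lemma stopped_process_enat: "S \<omega> = enat k \<Longrightarrow> stopped_process X S \<omega> n = X (min k n) \<omega>"
  by (simp add: stopped_process_def)

lemma stopped_process_in_space:
  assumes "\<And>n. X n \<in> \<Omega> \<rightarrow> space E" "\<omega> \<in> \<Omega>"
  shows "stopped_process X S \<omega> \<in> space (\<Pi>\<^sub>M n\<in>(UNIV :: nat set). E)"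
  using assms by (auto simp: space_PiM stopped_process_def Pi_iff)

text \<open>The product sigma-field is generated by the coordinate maps, so measurability of
  \<open>Z\<close> can be checked one coordinate at a time. Every later inclusion of a path field is
  reduced to coordinate events in this way.\<close>

lemma path_field_subset:
  assumes H: "sigma_algebra \<Omega> H"
    and Z: "\<And>\<omega>. \<omega> \<in> \<Omega> \<Longrightarrow> Z \<omega> \<in> space (\<Pi>\<^sub>M n\<in>(UNIV :: nat set). E)"
    and coord: "\<And>n C. C \<in> sets E \<Longrightarrow> {\<omega>\<in>\<Omega>. Z \<omega> n \<in> C} \<in> H"
  shows "path_field \<Omega> E Z \<subseteq> H"
proof -
  interpret H: sigma_algebra \<Omega> H by (rule H)
  \<comment> \<open>Wrapping \<open>H\<close> as a measure makes the measurability rules applicable;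
    no sets are added, since \<open>H\<close> is already a sigma-algebra.\<close>
  have sets: "sets (sigma \<Omega> H) = H" and space: "space (sigma \<Omega> H) = \<Omega>"
    by (simp_all add: H.space_closed space_measure_of)
  have "Z \<in> sigma \<Omega> H \<rightarrow>\<^sub>M (\<Pi>\<^sub>M n\<in>(UNIV :: nat set). E)"
  proof (rule measurable_PiM_single')
    show "(\<lambda>\<omega>. Z \<omega> n) \<in> sigma \<Omega> H \<rightarrow>\<^sub>M E" for n
    proof (rule measurableI)
      show "Z \<omega> n \<in> space E" if "\<omega> \<in> space (sigma \<Omega> H)" for \<omega>
        using Z that by (auto simp: space space_PiM)
      show "(\<lambda>\<omega>. Z \<omega> n) -` C \<inter> space (sigma \<Omega> H) \<in> sets (sigma \<Omega> H)" if "C \<in> sets E" for C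
        using coord[OF that, of n] unfolding sets space by (simp add: vimage_def Int_def conj_commute)
    qed
    show "Z \<in> space (sigma \<Omega> H) \<rightarrow> UNIV \<rightarrow>\<^sub>E space E"
      using Z by (auto simp: space space_PiM)
  qed
  from sets_image_in_sets[OF space this] show ?thesis
    by (simp add: path_field_def sets)
qed

lemma path_field_coordinate:
  assumes Z: "\<And>\<omega>. \<omega> \<in> \<Omega> \<Longrightarrow> Z \<omega> \<in> space (\<Pi>\<^sub>M n\<in>(UNIV :: nat set). E)" and C: "C \<in> sets E"
  shows "{\<omega>\<in>\<Omega>. Z \<omega> n \<in> C} \<in> path_field \<Omega> E Z"
proof -
  have "(\<lambda>z. z n) -` C \<inter> space (\<Pi>\<^sub>M n\<in>(UNIV :: nat set). E) \<in> sets (\<Pi>\<^sub>M n\<in>(UNIV :: nat set). E)"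
    using C by (intro measurable_sets measurable_component_singleton) auto
  from in_vimage_algebra[OF this, of Z \<Omega>]
  have "Z -` ((\<lambda>z. z n) -` C \<inter> space (\<Pi>\<^sub>M n\<in>(UNIV :: nat set). E)) \<inter> \<Omega> \<in> path_field \<Omega> E Z"
    by (simp add: path_field_def)
  also have "Z -` ((\<lambda>z. z n) -` C \<inter> space (\<Pi>\<^sub>M n\<in>(UNIV :: nat set). E)) \<inter> \<Omega> = {\<omega>\<in>\<Omega>. Z \<omega> n \<in> C}"
    using Z by auto
  finally show ?thesis .
qed

lemma path_field_subset_Pow: "path_field \<Omega> E Z \<subseteq> Pow \<Omega>"
  using sets.sets_into_space by (fastforce simp: path_field_def)

section \<open>The stopped field as a completed path field\<close>

text \<open>Only one process and one measure occur, so that the two outer equalities of the theorem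
  are both instances.\<close>

lemma stopped_completed_field_eq:
  fixes P :: "'a measure" and E :: "'b measure" and X :: "nat \<Rightarrow> 'a \<Rightarrow> 'b" and S :: "'a \<Rightarrow> enat"
  defines "G \<equiv> completed_filtration P (natural_filtration (space P) E X)"
  assumes X: "\<And>n. X n \<in> space P \<rightarrow> space E"
    and stop: "enat_stopping_time (space P) G S"
  shows "stopped_field (space P) G S = completed_field P (path_field (space P) E (stopped_process X S))"
    (is "_ = ?H")
proof -
  let ?\<Omega> = "space P" and ?Z = "stopped_process X S"
  have G: "sigma_algebra ?\<Omega> (G n)" for n
    unfolding G_def completed_filtration_def
    using sigma_algebra_natural_filtration[of ?\<Omega> E X n]
    by (intro sigma_algebra_completed_field) (simp add: sigma_algebra_iff2)
  interpret G: sigma_algebra ?\<Omega> "G n" for n by (rule G)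
  interpret F: sigma_algebra ?\<Omega> "filtration_infty ?\<Omega> G"
    using G by (rule sigma_algebra_filtration_infty)
  have H: "sigma_algebra ?\<Omega> ?H"
    by (rule sigma_algebra_completed_field[OF path_field_subset_Pow])
  interpret H: sigma_algebra ?\<Omega> ?H by (rule H)
  have GF: "G n \<subseteq> filtration_infty ?\<Omega> G" for n
    by (rule filtration_infty_upper)
  have G_mono: "G m \<subseteq> G n" if "m \<le> n" for m n
    unfolding G_def completed_filtration_def
    using that by (intro completed_field_mono natural_filtration_mono)
  have null_G: "null_sets P \<subseteq> G n" for n
    unfolding G_def completed_filtration_def by (rule null_sets_subset_completed_field)
  have X_G: "{\<omega>\<in>?\<Omega>. X i \<omega> \<in> C} \<in> G n" if "i \<le> n" "C \<in> sets E" for i n C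
  proof -
    have "X i -` C \<inter> ?\<Omega> \<in> natural_filtration ?\<Omega> E X n"
      unfolding natural_filtration_def
      using that in_vimage_algebra[of C E "X i" ?\<Omega>] by (intro sigma_sets.Basic) auto
    then show ?thesis
      using subset_completed_field
      by (fastforce simp: G_def completed_filtration_def vimage_def Int_def conj_commute)
  qed
  have le: "{\<omega>\<in>?\<Omega>. S \<omega> \<le> enat n} \<in> G n" for n
    using stop by (simp add: enat_stopping_time_def)
  have eq: "{\<omega>\<in>?\<Omega>. S \<omega> = enat k} \<in> G n" if "k \<le> n" for k n
  proof (cases k)
    case 0
    then show ?thesis
      using le[of 0] G_mono[of 0 n] by (auto simp: zero_enat_def[symmetric])
  next
    case (Suc j)
    have "{\<omega>\<in>?\<Omega>. S \<omega> = enat k} = {\<omega>\<in>?\<Omega>. S \<omega> \<le> enat k} - {\<omega>\<in>?\<Omega>. S \<omega> \<le> enat j}"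
      using Suc by (auto simp: not_le Suc_ile_eq[symmetric])
    also have "\<dots> \<in> G n"
      using le[of k] le[of j] G_mono[of k n] G_mono[of j n] that Suc by (intro G.Diff) auto
    finally show ?thesis .
  qed
  have Z_space: "?Z \<omega> \<in> space (\<Pi>\<^sub>M n\<in>(UNIV :: nat set). E)" if "\<omega> \<in> ?\<Omega>" for \<omega>
    using X that by (rule stopped_process_in_space)
  have Z_H: "{\<omega>\<in>?\<Omega>. ?Z \<omega> n \<in> C} \<in> ?H" if "C \<in> sets E" for n C
    by (rule subsetD[OF subset_completed_field path_field_coordinate[OF Z_space that]])
  have null_H: "null_sets P \<subseteq> ?H"
    by (rule null_sets_subset_completed_field)
  \<comment> \<open>\<open>D\<close> is kept general because it will be \<open>{S \<ge> n}\<close>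
    in some uses and \<open>{S = \<infinity>}\<close> in another. \<open>G n\<close> is generated in
    two layers, so the trace principle is applied twice: to the natural filtration
    (\<open>gen\<close>), then to its completion.\<close>
  have trace: "A \<inter> D \<in> ?H" if A: "A \<in> G n" and D: "D \<in> ?H" "D \<subseteq> {\<omega>\<in>?\<Omega>. enat n \<le> S \<omega>}" for A D n
  proof -
    have gen: "A \<inter> D \<in> ?H" if "A \<in> natural_filtration ?\<Omega> E X n" for A
      using that unfolding natural_filtration_def
    proof (rule sigma_sets_Int_in_sigma_algebra[OF H D(1), rotated])
      fix A assume "A \<in> (\<Union>i\<le>n. sets (vimage_algebra ?\<Omega> (X i) E))"
      then obtain i C where i: "i \<le> n" and C: "C \<in> sets E" and A: "A = X i -` C \<inter> ?\<Omega>"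
        using X by (auto simp: sets_vimage_algebra2)
      \<comment> \<open>On \<open>D\<close> we have \<open>i \<le> n \<le> S\<close>, so stopping
        has not yet altered the value at time \<open>i\<close>.\<close>
      have "?Z \<omega> i = X i \<omega>" if "\<omega> \<in> D" for \<omega>
        using D(2) that i by (intro stopped_process_eq) (auto intro: order_trans[of "enat i" "enat n"])
      then have "A \<inter> D = {\<omega>\<in>?\<Omega>. ?Z \<omega> i \<in> C} \<inter> D"
        by (auto simp: A)
      with Z_H[OF C] D(1) show "A \<inter> D \<in> ?H" by auto
    qed
    have "A \<in> sigma_sets ?\<Omega> (natural_filtration ?\<Omega> E X n \<union> null_sets P)"
      using A by (simp add: G_def completed_filtration_def completed_field_def)
    then show ?thesis
    proof (rule sigma_sets_Int_in_sigma_algebra[OF H D(1), rotated])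
      show "B \<inter> D \<in> ?H" if "B \<in> natural_filtration ?\<Omega> E X n \<union> null_sets P" for B
        using that gen null_H H.Int[OF _ D(1)] by blast
    qed
  qed
  have ge: "{\<omega>\<in>?\<Omega>. enat n \<le> S \<omega>} \<in> ?H" for n
  proof (induction n)
    case 0
    then show ?case by (simp add: zero_enat_def[symmetric])
  next
    case (Suc n)
    \<comment> \<open>The set removed is \<open>{S = n}\<close>, written as the trace of an event of
      \<open>G n\<close> on \<open>{S \<ge> n}\<close> so that \<open>trace\<close> applies with the
      induction hypothesis.\<close>
    have "{\<omega>\<in>?\<Omega>. enat (Suc n) \<le> S \<omega>} =
        {\<omega>\<in>?\<Omega>. enat n \<le> S \<omega>} - {\<omega>\<in>?\<Omega>. S \<omega> \<le> enat n} \<inter> {\<omega>\<in>?\<Omega>. enat n \<le> S \<omega>}"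
      by (auto simp: Suc_ile_eq)
    with trace[OF le Suc] Suc show ?case by auto
  qed
  have infty_eq: "{\<omega>\<in>?\<Omega>. S \<omega> = \<infinity>} = (\<Inter>n. {\<omega>\<in>?\<Omega>. enat n \<le> S \<omega>})"
  proof -
    have "x = \<infinity>" if "\<forall>n. enat n \<le> x" for x
    proof (cases x)
      case (enat k)
      with that have "enat (Suc k) \<le> enat k" by blast
      then show ?thesis by simp
    qed
    then show ?thesis by auto
  qed
  have infty: "{\<omega>\<in>?\<Omega>. S \<omega> = \<infinity>} \<in> ?H"
    unfolding infty_eq using ge by (intro H.countable_INT) auto
  show ?thesis
  proof
    show "stopped_field ?\<Omega> G S \<subseteq> ?H"
    proof
      fix A assume A: "A \<in> stopped_field ?\<Omega> G S"
      \<comment> \<open>This is \<open>A\<close> on \<open>{S = n}\<close>: membership in the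
        stopped field puts the first intersection in \<open>G n\<close>, and the last factor serves
        as \<open>D\<close>.\<close>
      have "A \<inter> {\<omega>\<in>?\<Omega>. S \<omega> \<le> enat n} \<inter> {\<omega>\<in>?\<Omega>. enat n \<le> S \<omega>} \<in> ?H" for n
        using A by (intro trace[of _ n] ge) (auto simp: stopped_field_def)
      then have fin: "(\<Union>n. A \<inter> {\<omega>\<in>?\<Omega>. S \<omega> \<le> enat n} \<inter> {\<omega>\<in>?\<Omega>. enat n \<le> S \<omega>}) \<in> ?H"
        by (intro H.countable_UN) auto
      have "A \<in> filtration_infty ?\<Omega> G"
        using A by (simp add: stopped_field_def)
      \<comment> \<open>Here \<open>A\<close> is known only to be in the join of all
        \<open>G n\<close>. As \<open>{S = \<infinity>}\<close> lies in \<open>{S \<ge> n}\<close>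
        for every \<open>n\<close>, \<open>trace\<close> handles the generators from each
        \<open>G n\<close>.\<close>
      then have inf: "A \<inter> {\<omega>\<in>?\<Omega>. S \<omega> = \<infinity>} \<in> ?H"
        unfolding filtration_infty_def
      proof (rule sigma_sets_Int_in_sigma_algebra[OF H infty, rotated])
        show "B \<inter> {\<omega>\<in>?\<Omega>. S \<omega> = \<infinity>} \<in> ?H" if "B \<in> (\<Union>n. G n)" for B
          using that infty by (auto intro!: trace)
      qed
      have "A \<subseteq> ?\<Omega>"
        using \<open>A \<in> filtration_infty ?\<Omega> G\<close> by (rule F.sets_into_space)
      then have "A = (\<Union>n. A \<inter> {\<omega>\<in>?\<Omega>. S \<omega> \<le> enat n} \<inter> {\<omega>\<in>?\<Omega>. enat n \<le> S \<omega>})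
          \<union> A \<inter> {\<omega>\<in>?\<Omega>. S \<omega> = \<infinity>}" (is "_ = ?R")
      proof (intro equalityI subsetI)
        fix \<omega> assume "\<omega> \<in> A"
        with \<open>A \<subseteq> ?\<Omega>\<close> show "\<omega> \<in> ?R" by (cases "S \<omega>") auto
      qed auto
      with H.Un[OF fin inf] show "A \<in> ?H" by simp
    qed
    show "?H \<subseteq> stopped_field ?\<Omega> G S"
    proof (rule completed_field_subset)
      show SF: "sigma_algebra ?\<Omega> (stopped_field ?\<Omega> G S)"
        using G stop by (rule sigma_algebra_stopped_field)
      show "null_sets P \<subseteq> stopped_field ?\<Omega> G S"
      proof
        fix N assume "N \<in> null_sets P"
        then have "N \<in> G n" for n using null_G by blast
        then show "N \<in> stopped_field ?\<Omega> G S"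
          using GF le by (auto simp: stopped_field_def)
      qed
      show "path_field ?\<Omega> E ?Z \<subseteq> stopped_field ?\<Omega> G S"
      proof (rule path_field_subset[OF SF Z_space])
        fix m C assume C: "C \<in> sets E"
        \<comment> \<open>\<open>?B k\<close> is the part of the coordinate event on
          \<open>{S = k}\<close>. Since \<open>min k m \<le> k\<close>, it lies in
          \<open>G n\<close> whenever \<open>k \<le> n\<close>, even if \<open>m\<close> exceeds
          \<open>n\<close>.\<close>
        let ?B = "\<lambda>k. {\<omega>\<in>?\<Omega>. S \<omega> = enat k} \<inter> {\<omega>\<in>?\<Omega>. X (min k m) \<omega> \<in> C}"
        have B: "?B k \<in> G n" if "k \<le> n" for k n
          using eq[OF that] X_G[OF _ C, of "min k m" n] that by auto
        have "{\<omega>\<in>?\<Omega>. ?Z \<omega> m \<in> C} \<inter> {\<omega>\<in>?\<Omega>. S \<omega> \<le> enat n} = (\<Union>k\<le>n. ?B k)" for n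
        proof (rule set_eqI)
          fix \<omega> show "\<omega> \<in> {\<omega>\<in>?\<Omega>. ?Z \<omega> m \<in> C} \<inter> {\<omega>\<in>?\<Omega>. S \<omega> \<le> enat n} \<longleftrightarrow> \<omega> \<in> (\<Union>k\<le>n. ?B k)"
            by (cases "S \<omega>") (auto simp: stopped_process_enat)
        qed
        then have loc: "{\<omega>\<in>?\<Omega>. ?Z \<omega> m \<in> C} \<inter> {\<omega>\<in>?\<Omega>. S \<omega> \<le> enat n} \<in> G n" for n
          using B by (auto intro!: G.finite_UN)
        \<comment> \<open>The conditions at finite times say nothing about
          \<open>{S = \<infinity>}\<close>, so membership in the join is shown separately; on that
          set the coordinate is \<open>X m\<close>.\<close>
        have "{\<omega>\<in>?\<Omega>. S \<omega> = \<infinity>} = ?\<Omega> - (\<Union>n. {\<omega>\<in>?\<Omega>. S \<omega> = enat n})"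
          by auto
        also have "\<dots> \<in> filtration_infty ?\<Omega> G"
          using eq[OF order_refl] GF by (intro F.compl_sets F.countable_UN image_subsetI) (rule subsetD)
        finally have F_inf: "{\<omega>\<in>?\<Omega>. S \<omega> = \<infinity>} \<in> filtration_infty ?\<Omega> G" .
        have "(\<Union>k. ?B k) \<in> filtration_infty ?\<Omega> G"
          using B[OF order_refl] GF by (intro F.countable_UN image_subsetI) (rule subsetD)
        moreover have "{\<omega>\<in>?\<Omega>. S \<omega> = \<infinity>} \<inter> {\<omega>\<in>?\<Omega>. X m \<omega> \<in> C} \<in> filtration_infty ?\<Omega> G"
          using F_inf X_G[OF order_refl C] GF by (intro F.Int) auto
        ultimately have "(\<Union>k. ?B k) \<union> {\<omega>\<in>?\<Omega>. S \<omega> = \<infinity>} \<inter> {\<omega>\<in>?\<Omega>. X m \<omega> \<in> C} \<in> filtration_infty ?\<Omega> G"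
          by (rule F.Un)
        also have "(\<Union>k. ?B k) \<union> {\<omega>\<in>?\<Omega>. S \<omega> = \<infinity>} \<inter> {\<omega>\<in>?\<Omega>. X m \<omega> \<in> C} = {\<omega>\<in>?\<Omega>. ?Z \<omega> m \<in> C}"
          (is "?L = ?R")
        proof (rule set_eqI)
          fix \<omega> show "\<omega> \<in> ?L \<longleftrightarrow> \<omega> \<in> ?R"
            by (cases "S \<omega>") (auto simp: stopped_process_enat stopped_process_eq)
        qed
        finally show "{\<omega>\<in>?\<Omega>. ?Z \<omega> m \<in> C} \<in> stopped_field ?\<Omega> G S"
          using loc by (simp add: stopped_field_def)
      qed
    qed
  qed
qed

section \<open>Modification on a null set and the chain of equalities\<close>

text \<open>Corresponding coordinate events of \<open>Z\<close> and \<open>W\<close> differ only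
  inside a null set, and by completeness such differences are null sets themselves. Exchanging
  \<open>Z\<close> and \<open>W\<close> gives the reverse inclusion.\<close>

lemma completed_path_field_mono_AE_eq:
  assumes P: "complete_measure P"
    and W: "\<And>\<omega>. \<omega> \<in> space P \<Longrightarrow> W \<omega> \<in> space (\<Pi>\<^sub>M n\<in>(UNIV :: nat set). E)"
    and Z: "\<And>\<omega>. \<omega> \<in> space P \<Longrightarrow> Z \<omega> \<in> space (\<Pi>\<^sub>M n\<in>(UNIV :: nat set). E)"
    and ae: "{\<omega>\<in>space P. Z \<omega> \<noteq> W \<omega>} \<in> null_sets P"
  shows "completed_field P (path_field (space P) E Z) \<subseteq> completed_field P (path_field (space P) E W)"
    (is "_ \<subseteq> ?H")
proof (rule completed_field_subset)
  interpret P: complete_measure P by (rule P)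
  show H: "sigma_algebra (space P) ?H"
    by (rule sigma_algebra_completed_field[OF path_field_subset_Pow])
  interpret H: sigma_algebra "space P" ?H by (rule H)
  show null: "null_sets P \<subseteq> ?H"
    by (rule null_sets_subset_completed_field)
  show "path_field (space P) E Z \<subseteq> ?H"
  proof (rule path_field_subset[OF H Z])
    fix n C assume C: "C \<in> sets E"
    let ?z = "{\<omega>\<in>space P. Z \<omega> n \<in> C}" and ?w = "{\<omega>\<in>space P. W \<omega> n \<in> C}"
    have "?z - ?w \<subseteq> {\<omega>\<in>space P. Z \<omega> \<noteq> W \<omega>}" "?w - ?z \<subseteq> {\<omega>\<in>space P. Z \<omega> \<noteq> W \<omega>}"
      by auto
    then have "?z - ?w \<in> ?H" "?w - ?z \<in> ?H"
      using P.complete2[OF _ ae] null by blast+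
    moreover have "?w \<in> ?H"
      by (rule subsetD[OF subset_completed_field path_field_coordinate[OF W C]])
    \<comment> \<open>\<open>?z\<close> is recovered from \<open>?w\<close> by deleting one null set
      and adjoining another.\<close>
    ultimately have "(?w - (?w - ?z)) \<union> (?z - ?w) \<in> ?H" by blast
    also have "(?w - (?w - ?z)) \<union> (?z - ?w) = ?z" by blast
    finally show "?z \<in> ?H" .
  qed
qed

theorem corollary7p14:
  fixes \<Omega> :: "'a set" and E :: "'b measure"
    and X Y :: "nat \<Rightarrow> 'a \<Rightarrow> 'b"
    and PX PY :: "'a measure"
    and S :: "'a \<Rightarrow> enat"
  assumes "\<And>n. X n \<in> \<Omega> \<rightarrow> space E"
    and "\<And>n. Y n \<in> \<Omega> \<rightarrow> space E"
    and "prob_space PX" and "complete_measure PX" and "space PX = \<Omega>"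
    and "prob_space PY" and "complete_measure PY" and "space PY = \<Omega>"
    and "filtration_infty \<Omega> (natural_filtration \<Omega> E X) \<subseteq> sets PX"
    and "filtration_infty \<Omega> (natural_filtration \<Omega> E Y) \<subseteq> sets PY"
    and "null_sets PX = null_sets PY"
    and "enat_stopping_time \<Omega> (completed_filtration PX (natural_filtration \<Omega> E X)) S"
    and "enat_stopping_time \<Omega> (completed_filtration PY (natural_filtration \<Omega> E Y)) S"
    and "{\<omega>\<in>\<Omega>. stopped_process X S \<omega> \<noteq> stopped_process Y S \<omega>} \<in> null_sets PX"
    and "{\<omega>\<in>\<Omega>. stopped_process X S \<omega> \<noteq> stopped_process Y S \<omega>} \<in> null_sets PY"
  shows "stopped_field \<Omega> (completed_filtration PX (natural_filtration \<Omega> E X)) S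
           = completed_field PX (path_field \<Omega> E (stopped_process X S))
       \<and> completed_field PX (path_field \<Omega> E (stopped_process X S))
           = completed_field PY (path_field \<Omega> E (stopped_process Y S))
       \<and> completed_field PY (path_field \<Omega> E (stopped_process Y S))
           = stopped_field \<Omega> (completed_filtration PY (natural_filtration \<Omega> E Y)) S"
proof -
  note X = assms(1) and Y = assms(2) and PX = assms(4,5) and PY = assms(7,8)
    and null = assms(11) and stop = assms(12,13) and ae = assms(14)
  have ae': "{\<omega>\<in>\<Omega>. stopped_process Y S \<omega> \<noteq> stopped_process X S \<omega>} \<in> null_sets PX"
    using ae by (simp add: eq_commute)
  have sp: "stopped_process X S \<omega> \<in> space (\<Pi>\<^sub>M n\<in>(UNIV :: nat set). E)"
    "stopped_process Y S \<omega> \<in> space (\<Pi>\<^sub>M n\<in>(UNIV :: nat set). E)" if "\<omega> \<in> space PX" for \<omega>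
    using stopped_process_in_space[of X \<Omega> E \<omega> S, OF X] stopped_process_in_space[of Y \<Omega> E \<omega> S, OF Y] that
    by (simp_all add: PX(2))
  note mono = completed_path_field_mono_AE_eq[OF PX(1), unfolded PX(2)]
  \<comment> \<open>The middle equality changes one thing at a time: first the process, with
    \<open>PX\<close> fixed, then the measure.\<close>
  have "completed_field PX (path_field \<Omega> E (stopped_process X S))
      = completed_field PX (path_field \<Omega> E (stopped_process Y S))"
  proof
    show "completed_field PX (path_field \<Omega> E (stopped_process X S))
        \<subseteq> completed_field PX (path_field \<Omega> E (stopped_process Y S))"
      by (rule mono) (use sp ae in \<open>simp_all add: PX(2)\<close>)
    show "completed_field PX (path_field \<Omega> E (stopped_process Y S))
        \<subseteq> completed_field PX (path_field \<Omega> E (stopped_process X S))"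
      by (rule mono) (use sp ae' in \<open>simp_all add: PX(2)\<close>)
  qed
  \<comment> \<open>A completion depends on the measure only through its space and its null sets,
    which \<open>PX\<close> and \<open>PY\<close> share.\<close>
  also have "\<dots> = completed_field PY (path_field \<Omega> E (stopped_process Y S))"
    using null PX(2) PY(2) by (simp add: completed_field_def)
  finally show ?thesis
    using stopped_completed_field_eq[of X PX E S, unfolded PX(2), OF X stop(1)]
      stopped_completed_field_eq[of Y PY E S, unfolded PY(2), OF Y stop(2)]
    by simp
qed

end
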